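(* Let $m\ge2$ and let $X_m$ be a random variable with the $\mathrm{PF\text{-}CME}_m$ density $f_m(t)=C_m e^{-t}W_m(\omega_m(t-1))$, $t\ge0$. For $k=0,1,2$, define $$M_k(m):=B_{0,m}J_k(0)+2\sum_{\ell=1}^{L_m}B_{\ell,m}\Bigl(\cos(\ell\omega_m)J_k(\ell\omega_m)+\sin(\ell\omega_m)S_k(\ell\omega_m)\Bigr).$$ Then $$C_m=M_0(m)^{-1},\qquad \mathbb{E}[X_m]=\frac{M_1(m)}{M_0(m)},\qquad \mathbb{E}[X_m^2]=\frac{M_2(m)}{M_0(m)},\qquad \mathrm{SCV}(X_m)=\frac{M_2(m)M_0(m)}{M_1(m)^2}-1.$$
   Context: $\log$ is the natural logarithm. For an integer $m\ge2$, the Fejér kernel of order $m$ is $$\Phi_m(\theta)=1+2\sum_{\ell=1}^{m-1}\left(1-\frac{\ell}{m}\right)\cos(\ell\theta)=\frac1m\left(\frac{\sin(m\theta/2)}{\sin(\theta/2)}\right)^2,$$ the last expression being understood by continuity at multiples of $2\pi$. Set $$r_m:=\lceil\log m\rceil,\quad h_m:=2\log m+\log\log m,\quad \omega_m:=\frac{2\pi}{h_m},\quad W_m(\theta):=(\Phi_m(\theta))^{r_m},\quad L_m:=r_m(m-1).$$ The powered-Fejér concentrated matrix-exponential density of index $m$ ($\mathrm{PF\text{-}CME}_m$) is $$f_m(t)=C_m\,e^{-t}\,W_m(\omega_m(t-1)),\qquad t\ge0,$$ where $C_m>0$ is the normalizing constant making $\int_0^\infty f_m(t)\,dt=1$. Let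 $\gamma_k=1-|k|/m$ for integers $|k|\le m-1$ and $\gamma_k=0$ for all other $k\in\mathbb{Z}$. $B_{\ell,m}$ denotes the $\ell$-th entry of the $r_m$-fold discrete convolution of the sequence $(\gamma_k)_{k\in\mathbb{Z}}$ with itself ($r_m$ factors), so that $$W_m(\theta)=B_{0,m}+2\sum_{\ell=1}^{L_m}B_{\ell,m}\cos(\ell\theta).$$ The functions $J_k,S_k$ of a real variable $a$ are $J_k(a)=\int_0^\infty t^ke^{-t}\cos(at)\,dt$ and $S_k(a)=\int_0^\infty t^ke^{-t}\sin(at)\,dt$, i.e. $$J_0(a)=\frac{1}{1+a^2},\quad S_0(a)=\frac{a}{1+a^2},\quad J_1(a)=\frac{1-a^2}{(1+a^2)^2},\quad S_1(a)=\frac{2a}{(1+a^2)^2},$$ $$J_2(a)=\frac{2(1-3a^2)}{(1+a^2)^3},\quad S_2(a)=\frac{2a(3-a^2)}{(1+a^2)^3}.$$ The squared coefficient of variation is $\mathrm{SCV}(X)=\operatorname{Var}(X)/\mathbb{E}[X]^2$. *)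

theory Defs
  imports "HOL-Probability.Probability"
begin

definition fejer_kernel :: "nat \<Rightarrow> real \<Rightarrow> real" where
  "fejer_kernel m \<theta> = 1 + 2 * (\<Sum>l = 1..m - 1. (1 - real l / real m) * cos (real l * \<theta>))"

lemma fejer_kernel_mult_sin:
  assumes "m \<ge> 1"
  shows "real m * fejer_kernel m \<theta> * (sin (\<theta> / 2))\<^sup>2 = (sin (real m * \<theta> / 2))\<^sup>2"
proof -
  define s where "s = (\<lambda>n::nat. (\<Sum>l = 1..<n. cos (real l * \<theta>)))"
  define T where "T = (\<lambda>n::nat. real n + 2 * (\<Sum>l = 1..<n. (real n - real l) * cos (real l * \<theta>)))"
  define q where "q = sin (\<theta> / 2)"
  have prod: "2 * q * cos (real n * \<theta>) = sin (real n * \<theta> + \<theta> / 2) - sin (real n * \<theta> - \<theta> / 2)" for n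
    by (simp add: q_def sin_add sin_diff)
  have dirichlet: "q * (1 + 2 * s (Suc n)) = sin (real n * \<theta> + \<theta> / 2)" for n
  proof (induction n)
    case (Suc n)
    have "s (Suc (Suc n)) = s (Suc n) + cos (real (Suc n) * \<theta>)"
      by (simp add: s_def)
    then have "q * (1 + 2 * s (Suc (Suc n)))
        = q * (1 + 2 * s (Suc n)) + 2 * q * cos (real (Suc n) * \<theta>)"
      by (simp add: algebra_simps)
    also have "\<dots> = sin (real n * \<theta> + \<theta> / 2) + 2 * q * cos (real (Suc n) * \<theta>)"
      by (simp only: Suc.IH)
    also have "\<dots> = sin (real (Suc n) * \<theta> + \<theta> / 2)"
    proof -
      have "real (Suc n) * \<theta> - \<theta> / 2 = real n * \<theta> + \<theta> / 2"
        by (simp add: field_simps)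
      then show ?thesis unfolding prod by (simp add: add.commute)
    qed
    finally show ?case .
  qed (simp add: s_def q_def)
  have step: "T (Suc n) = T n + (1 + 2 * s (Suc n))" for n
  proof (cases "n = 0")
    case True
    then show ?thesis by (simp add: T_def s_def)
  next
    case False
    then show ?thesis
      by (simp add: T_def s_def algebra_simps sum.distrib sum_subtractf flip: sum_distrib_left)
  qed
  have main: "T n * q\<^sup>2 = (sin (real n * \<theta> / 2))\<^sup>2" for n
  proof (induction n)
    case (Suc n)
    have e: "real (Suc n) * \<theta> / 2 = (real n * \<theta> / 2) + \<theta> / 2"
      "real n * \<theta> + \<theta> / 2 = ((real n * \<theta> / 2) + \<theta> / 2) + (real n * \<theta> / 2)"
      by (simp_all add: field_simps)
    have sq: "sin (x + y)^2 = sin x ^2 + sin y * sin ((x + y) + x)" for x y :: real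
      using sin_cos_squared_add[of x] sin_cos_squared_add[of y]
      unfolding sin_add cos_add by algebra
    have "T (Suc n) * q\<^sup>2 = T n * q\<^sup>2 + q * (q * (1 + 2 * s (Suc n)))"
      by (simp add: step algebra_simps power2_eq_square)
    also have "\<dots> = (sin (real n * \<theta> / 2))\<^sup>2 + q * sin (real n * \<theta> + \<theta> / 2)"
      by (simp only: Suc.IH dirichlet)
    also have "\<dots> = (sin (real (Suc n) * \<theta> / 2))\<^sup>2"
      unfolding e q_def sq by simp
    finally show ?case .
  qed (simp add: T_def)
  have iv: "{1..m - 1} = {1..<m}" using assms by auto
  have "real m * fejer_kernel m \<theta> = T m"
    unfolding fejer_kernel_def T_def iv distrib_left sum_distrib_left
    using assms by (auto intro!: sum.cong simp: field_simps)
  then show ?thesis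
    using main[of m] by (simp add: q_def)
qed

lemma fejer_kernel_eq:
  assumes "m \<ge> 1" "sin (\<theta> / 2) \<noteq> 0"
  shows "fejer_kernel m \<theta> = (1 / real m) * (sin (real m * \<theta> / 2) / sin (\<theta> / 2))\<^sup>2"
  using fejer_kernel_mult_sin[OF assms(1), of \<theta>] assms by (simp add: field_simps)

definition pf_r :: "nat \<Rightarrow> nat" where
  "pf_r m = nat \<lceil>ln (real m)\<rceil>"

definition pf_h :: "nat \<Rightarrow> real" where
  "pf_h m = 2 * ln (real m) + ln (ln (real m))"

definition pf_omega :: "nat \<Rightarrow> real" where
  "pf_omega m = 2 * pi / pf_h m"

definition pf_W :: "nat \<Rightarrow> real \<Rightarrow> real" where
  "pf_W m \<theta> = fejer_kernel m \<theta> ^ pf_r m"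

definition pf_L :: "nat \<Rightarrow> nat" where
  "pf_L m = pf_r m * (m - 1)"

text \<open>A non-integrable function has Lebesgue integral \<open>0\<close>, so the value \<open>1\<close> below
  also forces integrability.\<close>

definition pf_C :: "nat \<Rightarrow> real" where
  "pf_C m = (THE C. C > 0 \<and>
     (LBINT t:{0..}. C * exp (- t) * pf_W m (pf_omega m * (t - 1))) = 1)"

definition pf_density :: "nat \<Rightarrow> real \<Rightarrow> real" where
  "pf_density m t = (if t \<ge> 0 then pf_C m * exp (- t) * pf_W m (pf_omega m * (t - 1)) else 0)"

definition convolution :: "(int \<Rightarrow> real) \<Rightarrow> (int \<Rightarrow> real) \<Rightarrow> int \<Rightarrow> real" where
  "convolution a b n = (\<Sum>\<^sub>\<infinity>k. a k * b (n - k))"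

text \<open>The \<open>r\<close>-fold convolution of \<open>a\<close> with itself (\<open>r\<close> factors);
  for \<open>r = 0\<close> it is the convolution unit.\<close>

fun convolution_power :: "(int \<Rightarrow> real) \<Rightarrow> nat \<Rightarrow> int \<Rightarrow> real" where
  "convolution_power a 0 = (\<lambda>n. if n = 0 then 1 else 0)"
| "convolution_power a (Suc r) = convolution a (convolution_power a r)"

definition fejer_coeff :: "nat \<Rightarrow> int \<Rightarrow> real" where
  "fejer_coeff m k = (if \<bar>k\<bar> \<le> int m - 1 then 1 - real_of_int \<bar>k\<bar> / real m else 0)"

definition pf_B :: "nat \<Rightarrow> int \<Rightarrow> real" where
  "pf_B m l = convolution_power (fejer_coeff m) (pf_r m) l"

definition J_int :: "nat \<Rightarrow> real \<Rightarrow> real" where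
  "J_int k a = (LBINT t:{0..}. t ^ k * exp (- t) * cos (a * t))"

definition S_int :: "nat \<Rightarrow> real \<Rightarrow> real" where
  "S_int k a = (LBINT t:{0..}. t ^ k * exp (- t) * sin (a * t))"

lemma power_exp_integrable:
  "set_integrable lborel {0..} (\<lambda>t::real. complex_of_real t ^ k * exp (- (Complex 1 (- a) * of_real t)))"
proof -
  have "integrable lborel (\<lambda>t::real. indicator {0..} t * (t ^ k * exp (- t)))"
  proof (rule integrableI_nonneg)
    have "(\<integral>\<^sup>+t. ennreal (indicator {0..} t * (t ^ k * exp (- t))) \<partial>lborel)
        = (\<integral>\<^sup>+t. ennreal (t ^ k * exp (- t)) * indicator {0..} t \<partial>lborel)"
      by (intro nn_integral_cong) (auto split: split_indicator)
    also have "\<dots> = ennreal (real_of_nat (fact k))"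
      by (rule nn_intergal_power_times_exp_Ici)
    finally show "(\<integral>\<^sup>+t. ennreal (indicator {0..} t * (t ^ k * exp (- t))) \<partial>lborel) < \<infinity>"
      by simp
  qed (auto split: split_indicator)
  then show ?thesis
    unfolding set_integrable_def
    by (rule Bochner_Integration.integrable_bound)
       (auto split: split_indicator simp: norm_mult norm_power)
qed

lemma power_exp_tendsto_0:
  "((\<lambda>t::real. complex_of_real t ^ k * exp (- (Complex 1 (- a) * of_real t))) \<longlongrightarrow> 0) at_top"
proof (rule tendsto_norm_zero_cancel, rule Lim_transform_eventually)
  show "((\<lambda>t::real. t ^ k / exp t) \<longlongrightarrow> 0) at_top"
    by (rule tendsto_power_div_exp_0)
  show "\<forall>\<^sub>F t::real in at_top. t ^ k / exp t
      = norm (complex_of_real t ^ k * exp (- (Complex 1 (- a) * of_real t)))"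
    using eventually_ge_at_top[of 0]
    by eventually_elim (simp add: norm_mult norm_power norm_exp_eq_Re divide_inverse flip: exp_minus)
qed

lemma FTC_Ici_zero_infinity:
  fixes F f :: "real \<Rightarrow> complex"
  assumes F: "\<And>t. (F has_vector_derivative f t) (at t)"
    and cont: "\<And>t. isCont f t"
    and int: "set_integrable lborel {0..} f"
    and lim: "(F \<longlongrightarrow> 0) at_top"
  shows "(LBINT t:{0..}. f t) = - F 0"
proof -
  have "set_integrable lborel {0<..} f"
    by (rule set_integrable_subset[OF int]) auto
  then have i: "set_integrable lborel (einterval 0 \<infinity>) f"
    unfolding zero_ereal_def by simp
  have "isCont F 0"
    using F[of 0] by (rule has_vector_derivative_continuous)
  then have "(F \<longlongrightarrow> F 0) (at_right 0)"
    by (auto simp: isCont_def intro: filterlim_at_split[THEN iffD1, THEN conjunct2])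
  then have "((F \<circ> real_of_ereal) \<longlongrightarrow> F 0) (at_right 0)"
    unfolding zero_ereal_def ereal_tendsto_simps .
  moreover have "((F \<circ> real_of_ereal) \<longlongrightarrow> 0) (at_left \<infinity>)"
    using lim unfolding ereal_tendsto_simps .
  ultimately have "(LBINT t=0..\<infinity>. f t) = 0 - F 0"
    using F cont i by (intro interval_integral_FTC_integrable) auto
  moreover have "(LBINT t=0..\<infinity>. f t) = (LBINT t:{0<..}. f t)"
    by (rule interval_lebesgue_integral_0_infty)
  moreover have "(LBINT t:{0<..}. f t) = (LBINT t:{0..}. f t)"
    unfolding set_lebesgue_integral_def
  proof (rule integral_cong_AE)
    have "isCont f t" for t by (rule cont)
    then have "continuous_on UNIV f"
      by (simp add: continuous_on_eq_continuous_at)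
    then have [measurable]: "f \<in> borel_measurable borel"
      by (rule borel_measurable_continuous_onI)
    show "(\<lambda>x. indicator {0<..} x *\<^sub>R f x) \<in> borel_measurable lborel"
      by measurable
    show "(\<lambda>x. indicator {0..} x *\<^sub>R f x) \<in> borel_measurable lborel"
      by measurable
    show "AE x in lborel. indicator {0<..} x *\<^sub>R f x = indicator {0..} x *\<^sub>R f x"
      using AE_lborel_singleton[of 0] by eventually_elim (auto split: split_indicator)
  qed
  ultimately show ?thesis by simp
qed

lemma power_exp_integral:
  "(LBINT t:{0..}. complex_of_real t ^ k * exp (- (Complex 1 (- a) * of_real t)))
    = fact k / Complex 1 (- a) ^ Suc k"
proof -
  define z where "z = Complex 1 (- a)"
  define g where "g = (\<lambda>k (t::real). complex_of_real t ^ k * exp (- (z * of_real t)))"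
  have z0: "z \<noteq> 0" by (auto simp: z_def complex_eq_iff)
  have int: "set_integrable lborel {0..} (g k)" for k
    unfolding g_def z_def by (rule power_exp_integrable)
  have lim: "(g k \<longlongrightarrow> 0) at_top" for k
    unfolding g_def z_def by (rule power_exp_tendsto_0)
  have cont: "isCont (g k) t" for k t
    unfolding g_def by (intro continuous_intros)
  have d0: "(g 0 has_vector_derivative - z * g 0 t) (at t)" for t
    unfolding g_def
    by (auto intro!: derivative_eq_intros has_vector_derivative_real_field)
  have dSuc: "(g (Suc k) has_vector_derivative (of_nat (Suc k) * g k t - z * g (Suc k) t)) (at t)" for k t
  proof -
    have "((\<lambda>w. w ^ Suc k * exp (- (z * w))) has_field_derivative
        (of_nat (Suc k) * w ^ k * exp (- (z * w)) + w ^ Suc k * (exp (- (z * w)) * - z))) (at w)" for w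
    proof -
      have "((\<lambda>w. w ^ Suc k) has_field_derivative of_nat (Suc k) * w ^ k) (at w)"
        using DERIV_power[OF DERIV_ident, of "Suc k" w UNIV] by (simp del: power_Suc of_nat_Suc)
      moreover have "((\<lambda>w. exp (- (z * w))) has_field_derivative exp (- (z * w)) * - z) (at w)"
        by (auto intro!: derivative_eq_intros)
      ultimately show ?thesis
        by (rule DERIV_mult[THEN DERIV_cong]) (simp add: algebra_simps)
    qed
    then show ?thesis
      unfolding g_def
      by (rule has_vector_derivative_real_field[OF DERIV_cong]) (simp add: algebra_simps)
  qed
  have "z ^ Suc k * (LBINT t:{0..}. g k t) = fact k"
  proof (induction k)
    case 0
    have "(LBINT t:{0..}. - z * g 0 t) = - g 0 0"
      using int cont by (intro FTC_Ici_zero_infinity d0 lim set_integrable_mult_right continuous_intros) auto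
    also have "(LBINT t:{0..}. - z * g 0 t) = - z * (LBINT t:{0..}. g 0 t)"
      by (rule set_integral_mult_right)
    finally show ?case by (simp add: g_def)
  next
    case (Suc k)
    have "(LBINT t:{0..}. of_nat (Suc k) * g k t - z * g (Suc k) t) = - g (Suc k) 0"
      using int cont by (intro FTC_Ici_zero_infinity dSuc lim set_integral_diff set_integrable_mult_right continuous_intros) auto
    also have "(LBINT t:{0..}. of_nat (Suc k) * g k t - z * g (Suc k) t)
        = of_nat (Suc k) * (LBINT t:{0..}. g k t) - z * (LBINT t:{0..}. g (Suc k) t)"
      using int by (simp only: set_integral_diff set_integrable_mult_right set_integral_mult_right)
    finally have "z * (LBINT t:{0..}. g (Suc k) t) = of_nat (Suc k) * (LBINT t:{0..}. g k t)"
      by (simp add: g_def)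
    then have "z ^ Suc k * (z * (LBINT t:{0..}. g (Suc k) t))
        = z ^ Suc k * (of_nat (Suc k) * (LBINT t:{0..}. g k t))"
      by simp
    then have "z ^ Suc (Suc k) * (LBINT t:{0..}. g (Suc k) t)
        = of_nat (Suc k) * (z ^ Suc k * (LBINT t:{0..}. g k t))"
      by (simp only: power_Suc mult_ac)
    also have "\<dots> = fact (Suc k)" by (simp only: Suc.IH) simp
    finally show ?case .
  qed
  then show ?thesis
    using z0 unfolding g_def z_def[symmetric] by (simp add: field_simps)
qed

lemma J_S_eq_Re_Im:
  "J_int k a = Re (fact k / Complex 1 (- a) ^ Suc k)"
  "S_int k a = Im (fact k / Complex 1 (- a) ^ Suc k)"
proof -
  let ?g = "\<lambda>t::real. indicator {0..} t *\<^sub>R (complex_of_real t ^ k * exp (- (Complex 1 (- a) * of_real t)))"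
  have i: "integrable lborel ?g"
    using power_exp_integrable[of k a] unfolding set_integrable_def .
  have e: "exp (- (Complex 1 (- a) * of_real t)) = exp (- t) *\<^sub>R cis (a * t)" for t
    by (simp add: complex_eq_iff exp_eq_polar Re_exp Im_exp)
  have p: "complex_of_real t ^ k = of_real (t ^ k)" for t by simp
  have "Re (LINT t|lborel. ?g t) = (LINT t|lborel. Re (?g t))"
    by (rule integral_Re[OF i, symmetric])
  also have "\<dots> = J_int k a"
    unfolding J_int_def set_lebesgue_integral_def e p
    by (intro Bochner_Integration.integral_cong) (simp_all del: of_real_power)
  finally have re: "Re (LINT t|lborel. ?g t) = J_int k a" . have "Im (LINT t|lborel. ?g t) = (LINT t|lborel. Im (?g t))"
    by (rule integral_Im[OF i, symmetric])
  also have "\<dots> = S_int k a"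
    unfolding S_int_def set_lebesgue_integral_def e p
    by (intro Bochner_Integration.integral_cong) (simp_all del: of_real_power)
  finally have im: "Im (LINT t|lborel. ?g t) = S_int k a" .
  show "J_int k a = Re (fact k / Complex 1 (- a) ^ Suc k)"
    "S_int k a = Im (fact k / Complex 1 (- a) ^ Suc k)"
    using re im power_exp_integral[of k a] unfolding set_lebesgue_integral_def by simp_all
qed

lemma J_S_closed_forms:
  "J_int 0 a = 1 / (1 + a\<^sup>2)"
  "S_int 0 a = a / (1 + a\<^sup>2)"
  "J_int 1 a = (1 - a\<^sup>2) / (1 + a\<^sup>2)\<^sup>2"
  "S_int 1 a = 2 * a / (1 + a\<^sup>2)\<^sup>2"
  "J_int 2 a = 2 * (1 - 3 * a\<^sup>2) / (1 + a\<^sup>2) ^ 3"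
  "S_int 2 a = 2 * a * (3 - a\<^sup>2) / (1 + a\<^sup>2) ^ 3"
proof -
  have nz: "1 + a\<^sup>2 \<noteq> 0" by (smt (verit) zero_le_power2)
  have key: "fact k / Complex 1 (- a) ^ Suc k = fact k * Complex 1 a ^ Suc k / of_real ((1 + a\<^sup>2) ^ Suc k)" for k
  proof -
    have "Complex 1 (- a) * Complex 1 a = of_real (1 + a\<^sup>2)"
      by (simp add: complex_eq_iff power2_eq_square)
    then have "Complex 1 (- a) ^ Suc k * Complex 1 a ^ Suc k = of_real ((1 + a\<^sup>2) ^ Suc k)"
      by (metis of_real_power power_mult_distrib)
    moreover have "Complex 1 (- a) \<noteq> 0"
      by (simp add: complex_eq_iff)
    then have "Complex 1 (- a) ^ Suc k \<noteq> 0"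
      by (rule power_not_zero)
    moreover have "complex_of_real ((1 + a\<^sup>2) ^ Suc k) \<noteq> 0"
      unfolding of_real_eq_0_iff using nz by simp
    moreover have "x / A = x * B / C" if "A * B = C" "A \<noteq> 0" "C \<noteq> 0" for x A B C :: complex
      using that by (auto simp: field_simps)
    ultimately show ?thesis by blast
  qed
  have fact2: "(fact 2 :: complex) = 2" by (simp add: fact_numeral)
  show "J_int 0 a = 1 / (1 + a\<^sup>2)" "S_int 0 a = a / (1 + a\<^sup>2)"
    "J_int 1 a = (1 - a\<^sup>2) / (1 + a\<^sup>2)\<^sup>2" "S_int 1 a = 2 * a / (1 + a\<^sup>2)\<^sup>2"
    "J_int 2 a = 2 * (1 - 3 * a\<^sup>2) / (1 + a\<^sup>2) ^ 3"
    "S_int 2 a = 2 * a * (3 - a\<^sup>2) / (1 + a\<^sup>2) ^ 3"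
    unfolding J_S_eq_Re_Im key Re_divide_of_real Im_divide_of_real
    by (simp_all add: fact2 numeral_2_eq_2 numeral_3_eq_3 power2_eq_square algebra_simps)
qed

definition pf_M :: "nat \<Rightarrow> nat \<Rightarrow> real" where
  "pf_M k m = pf_B m 0 * J_int k 0 +
     2 * (\<Sum>l = 1..pf_L m. pf_B m (int l) *
       (cos (real l * pf_omega m) * J_int k (real l * pf_omega m) +
        sin (real l * pf_omega m) * S_int k (real l * pf_omega m)))"

definition scv :: "'a measure \<Rightarrow> ('a \<Rightarrow> real) \<Rightarrow> real" where
  "scv P X = prob_space.variance P X / (prob_space.expectation P X)\<^sup>2"

end

theory Submission
  imports Defs
begin

text \<open>The Fejer kernel is the trigonometric polynomial with coefficients
  \<open>\<gamma>\<^sub>k\<close>, so its powers have the convolution powers of \<open>\<gamma>\<close> as coefficients. Since these are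
  even, \<open>W\<^sub>m\<close> is a cosine polynomial, and expanding \<open>cos (\<ell>\<omega>(t - 1))\<close> by the addition theorem
  turns the \<open>k\<close>-th moment of \<open>exp (- t) W\<^sub>m(\<omega>(t - 1))\<close> into \<open>M\<^sub>k\<close>. As \<open>W\<^sub>m\<close> is continuous,
  nonnegative and positive at \<open>0\<close>, all \<open>M\<^sub>k\<close> are positive, and the claims about \<open>X\<close> follow by
  normalising.\<close>

section \<open>Trigonometric polynomials and convolution\<close>

text \<open>Replaces the \<open>infsum\<close> of the definition by a finite sum; only the first
  factor has to have finite support.\<close>

lemma convolution_finite:
  assumes "finite A" "\<And>k. k \<notin> A \<Longrightarrow> a k = 0"
  shows "convolution a b n = (\<Sum>k\<in>A. a k * b (n - k))"
proof -
  have "convolution a b n = (\<Sum>\<^sub>\<infinity>k\<in>A. a k * b (n - k))"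
    unfolding convolution_def using assms(2) by (intro infsum_cong_neutral) auto
  then show ?thesis
    using assms(1) by simp
qed

text \<open>If \<bar>k\<bar> \<le> N, then \<bar>n - k\<bar> > M, so each term of the sum has a
  vanishing factor.\<close>

lemma convolution_eq_0:
  assumes a: "\<And>k. \<bar>k\<bar> > N \<Longrightarrow> a k = 0" and b: "\<And>k. \<bar>k\<bar> > M \<Longrightarrow> b k = 0"
    and n: "\<bar>n\<bar> > N + M"
  shows "convolution a b n = 0"
proof -
  have "a k * b (n - k) = 0" for k
    using a[of k] b[of "n - k"] n by (cases "\<bar>k\<bar> > N") auto
  then show ?thesis
    unfolding convolution_def by (intro infsum_0) simp
qed

lemma convolution_even:
  assumes "\<And>k. a (- k) = a k" "\<And>k. b (- k) = b k"
  shows "convolution a b (- n) = convolution a b n"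
proof -
  have "convolution a b (- n) = (\<Sum>\<^sub>\<infinity>k. a (- k) * b (- n - (- k)))"
    unfolding convolution_def
    by (rule infsum_reindex_bij_betw[symmetric, where g = uminus]) (rule bij_uminus)
  also have "\<dots> = convolution a b n"
    unfolding convolution_def
  proof (rule infsum_cong)
    show "a (- k) * b (- n - (- k)) = a k * b (n - k)" for k
      using assms(1)[of k] assms(2)[of "n - k"] by simp
  qed
  finally show ?thesis .
qed

text \<open>The Cauchy product of two Laurent polynomials in \<open>cis \<theta>\<close>: split
  \<open>cis (n * \<theta>)\<close> at k and n - k, then exchange the two sums.\<close>

lemma sum_cis_convolution:
  fixes N M :: int
  assumes a: "\<And>k. \<bar>k\<bar> > N \<Longrightarrow> a k = 0" and b: "\<And>k. \<bar>k\<bar> > M \<Longrightarrow> b k = 0"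
  shows "(\<Sum>n\<in>{-(N + M)..N + M}. of_real (convolution a b n) * cis (of_int n * \<theta>))
    = (\<Sum>k\<in>{-N..N}. of_real (a k) * cis (of_int k * \<theta>))
      * (\<Sum>k\<in>{-M..M}. of_real (b k) * cis (of_int k * \<theta>))"
proof -
  let ?C = "{-(N + M)..N + M}"
  let ?b = "\<lambda>j. of_real (b j) * cis (of_int j * \<theta>)"
  have conv: "convolution a b n = (\<Sum>k\<in>{-N..N}. a k * b (n - k))" for n
    using a by (intro convolution_finite) auto
  have cis: "cis (of_int n * \<theta>) = cis (of_int k * \<theta>) * cis (of_int (n - k) * \<theta>)" for n k
    by (simp add: cis_mult algebra_simps)
  have shift: "(\<Sum>n\<in>?C. ?b (n - k)) = (\<Sum>j\<in>{-M..M}. ?b j)" if k: "k \<in> {-N..N}" for k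
  proof -
    have "(\<Sum>j\<in>{-M..M}. ?b j) = (\<Sum>n\<in>{k-M..k+M}. ?b (n - k))"
      by (rule sum.reindex_bij_witness[where i = "\<lambda>n. n - k" and j = "\<lambda>j. j + k"]) auto
    \<comment> \<open>Since \<bar>k\<bar> \<le> N, the shifted range lies inside \<open>?C\<close>,
      and the additional terms vanish because \<bar>n - k\<bar> > M there.\<close>
    also have "\<dots> = (\<Sum>n\<in>?C. ?b (n - k))"
      using k b by (intro sum.mono_neutral_left) auto
    finally show ?thesis ..
  qed
  have "(\<Sum>n\<in>?C. of_real (convolution a b n) * cis (of_int n * \<theta>))
      = (\<Sum>n\<in>?C. \<Sum>k\<in>{-N..N}. (of_real (a k) * cis (of_int k * \<theta>)) * ?b (n - k))"
    unfolding conv of_real_sum sum_distrib_right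
  proof (intro sum.cong refl)
    fix n k
    show "of_real (a k * b (n - k)) * cis (of_int n * \<theta>)
        = (of_real (a k) * cis (of_int k * \<theta>)) * ?b (n - k)"
      unfolding cis[of n k] by (simp only: of_real_mult mult_ac)
  qed
  also have "\<dots> = (\<Sum>k\<in>{-N..N}. (of_real (a k) * cis (of_int k * \<theta>)) * (\<Sum>n\<in>?C. ?b (n - k)))"
    by (subst sum.swap) (simp add: sum_distrib_left)
  also have "\<dots> = (\<Sum>k\<in>{-N..N}. (of_real (a k) * cis (of_int k * \<theta>)) * (\<Sum>j\<in>{-M..M}. ?b j))"
    by (intro sum.cong refl) (simp only: shift)
  finally show ?thesis
    by (simp only: sum_distrib_right)
qed

text \<open>The imaginary parts of the terms at l and -l cancel; each induction step adds one such
  pair.\<close>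

lemma sum_cis_even:
  assumes "\<And>k. c (- k) = c k"
  shows "(\<Sum>k\<in>{- int N..int N}. of_real (c k) * cis (of_int k * \<theta>))
    = of_real (c 0 + 2 * (\<Sum>l = 1..N. c (int l) * cos (real l * \<theta>)))"
proof (induction N)
  case (Suc N)
  have iv: "{- int (Suc N)..int (Suc N)}
      = insert (- int (Suc N)) (insert (int (Suc N)) {- int N..int N})"
    by auto
  have pair: "cis (of_int (- int (Suc N)) * \<theta>) + cis (of_int (int (Suc N)) * \<theta>)
      = of_real (2 * cos (real (Suc N) * \<theta>))"
    by (simp add: complex_eq_iff del: of_nat_Suc)
  have "(\<Sum>k\<in>{- int (Suc N)..int (Suc N)}. of_real (c k) * cis (of_int k * \<theta>))
      = of_real (c (int (Suc N)))
          * (cis (of_int (- int (Suc N)) * \<theta>) + cis (of_int (int (Suc N)) * \<theta>))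
        + (\<Sum>k\<in>{- int N..int N}. of_real (c k) * cis (of_int k * \<theta>))"
    unfolding iv using assms[of "int (Suc N)"]
    by (subst sum.insert; simp add: distrib_left del: of_int_minus of_nat_Suc)+
  also have "\<dots> = of_real (c 0 + 2 * (\<Sum>l = 1..Suc N. c (int l) * cos (real l * \<theta>)))"
    unfolding pair Suc.IH by (simp add: algebra_simps)
  finally show ?case .
qed simp

lemma convolution_power_even:
  assumes "\<And>k. a (- k) = a k"
  shows "convolution_power a r (- n) = convolution_power a r n"
  by (induction r arbitrary: n) (auto intro!: convolution_even assms)

lemma convolution_power_eq_0:
  assumes "\<And>k. \<bar>k\<bar> > N \<Longrightarrow> a k = 0"
  shows "\<bar>n\<bar> > int r * N \<Longrightarrow> convolution_power a r n = 0"
proof (induction r arbitrary: n)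
  case (Suc r)
  then show ?case
    using assms convolution_eq_0[of N a "int r * N" "convolution_power a r" n]
    by (simp add: algebra_simps)
qed simp

text \<open>Iterates \<open>sum_cis_convolution\<close>, the support growing by N with each factor.
  For r = 0 the convolution unit matches the empty product.\<close>

lemma sum_cis_convolution_power:
  assumes "\<And>k. \<bar>k\<bar> > N \<Longrightarrow> a k = 0"
  shows "(\<Sum>n\<in>{-(int r * N)..int r * N}. of_real (convolution_power a r n) * cis (of_int n * \<theta>))
    = (\<Sum>k\<in>{-N..N}. of_real (a k) * cis (of_int k * \<theta>)) ^ r"
proof (induction r)
  case (Suc r)
  have "int (Suc r) * N = N + int r * N"
    by (simp add: algebra_simps)
  then show ?case
    using sum_cis_convolution[of N a "int r * N" "convolution_power a r" \<theta>]
      assms convolution_power_eq_0[of N a r] Suc.IH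
    by (simp del: of_nat_Suc)
qed simp

section \<open>The powered Fejer kernel\<close>

lemma fejer_kernel_sum_cis:
  assumes "m \<ge> 1"
  shows "complex_of_real (fejer_kernel m \<theta>)
    = (\<Sum>k\<in>{- int (m - 1)..int (m - 1)}. of_real (fejer_coeff m k) * cis (of_int k * \<theta>))"
proof -
  have "fejer_coeff m (- k) = fejer_coeff m k" for k
    by (simp add: fejer_coeff_def)
  note s = sum_cis_even[of "fejer_coeff m", OF this]
  have "fejer_kernel m \<theta>
      = fejer_coeff m 0 + 2 * (\<Sum>l = 1..m - 1. fejer_coeff m (int l) * cos (real l * \<theta>))"
    unfolding fejer_kernel_def using assms by (auto simp: fejer_coeff_def intro!: sum.cong)
  then show ?thesis
    by (simp only: s)
qed

text \<open>The power is expanded over the complex numbers, where multiplying kernels convolves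
  coefficients; evenness of the coefficients brings the result back to real cosines.\<close>

lemma pf_W_cosine_expansion:
  assumes "m \<ge> 1"
  shows "pf_W m \<theta> = pf_B m 0 + 2 * (\<Sum>l = 1..pf_L m. pf_B m (int l) * cos (real l * \<theta>))"
proof -
  have supp: "fejer_coeff m k = 0" if "\<bar>k\<bar> > int (m - 1)" for k
    using that assms by (simp add: fejer_coeff_def of_nat_diff)
  have even: "pf_B m (- n) = pf_B m n" for n
    unfolding pf_B_def by (rule convolution_power_even) (simp add: fejer_coeff_def)
  have L: "int (pf_r m) * int (m - 1) = int (pf_L m)"
    by (simp add: pf_L_def)
  have "complex_of_real (pf_W m \<theta>)
      = (\<Sum>n\<in>{- int (pf_L m)..int (pf_L m)}. of_real (pf_B m n) * cis (of_int n * \<theta>))"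
    unfolding pf_W_def pf_B_def L[symmetric] of_real_power fejer_kernel_sum_cis[OF assms]
    by (rule sum_cis_convolution_power[symmetric]) (rule supp)
  also have "\<dots> = of_real (pf_B m 0 + 2 * (\<Sum>l = 1..pf_L m. pf_B m (int l) * cos (real l * \<theta>)))"
    by (rule sum_cis_even) (rule even)
  finally show ?thesis
    by (simp only: of_real_eq_iff)
qed

lemma continuous_on_fejer_kernel [continuous_intros]:
  fixes S :: "real set"
  assumes "continuous_on S f"
  shows "continuous_on S (\<lambda>t. fejer_kernel m (f t))"
  unfolding fejer_kernel_def by (intro continuous_intros assms)

lemma continuous_on_pf_W [continuous_intros]:
  fixes S :: "real set"
  assumes "continuous_on S f"
  shows "continuous_on S (\<lambda>t. pf_W m (f t))"
  unfolding pf_W_def by (intro continuous_intros assms)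

lemma fejer_kernel_0: "fejer_kernel m 0 > 0"
  unfolding fejer_kernel_def
  by (intro add_pos_nonneg mult_nonneg_nonneg sum_nonneg) (auto simp: field_simps)

text \<open>Away from the zeros of \<open>sin (\<theta> / 2)\<close> the kernel is a square divided
  by m. At such a zero, \<theta> is a multiple of 2 * pi, and by periodicity the kernel takes its
  value at 0.\<close>

lemma fejer_kernel_nonneg:
  assumes "m \<ge> 1"
  shows "fejer_kernel m \<theta> \<ge> 0"
proof (cases "sin (\<theta> / 2) = 0")
  case False
  then show ?thesis
    using fejer_kernel_eq[OF assms] by simp
next
  case True
  then obtain i :: int where "\<theta> / 2 = of_int i * pi"
    by (auto simp: sin_zero_iff_int2)
  then have "\<theta> = 2 * pi * of_int i"
    by simp
  then have "real l * \<theta> = 2 * pi * of_int (int l * i)" for l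
    by simp
  then have "cos (real l * \<theta>) = 1" for l
    using cos_int_2pin by metis
  then have "fejer_kernel m \<theta> = fejer_kernel m 0"
    by (simp add: fejer_kernel_def)
  then show ?thesis
    using fejer_kernel_0[of m] by simp
qed

lemma pf_W_nonneg: "m \<ge> 1 \<Longrightarrow> pf_W m \<theta> \<ge> 0"
  by (simp add: pf_W_def fejer_kernel_nonneg)

section \<open>Moments\<close>

text \<open>Both integrands are dominated by the norm of the complex integrand of
  \<open>power_exp_integrable\<close>, which is \<open>t ^ k * exp (- t)\<close> on the
  half-line.\<close>

lemma set_integrable_power_exp_cos_sin:
  "set_integrable lborel {0..} (\<lambda>t::real. t ^ k * exp (- t) * cos (a * t))"
  "set_integrable lborel {0..} (\<lambda>t::real. t ^ k * exp (- t) * sin (a * t))"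
  using power_exp_integrable[of k a] unfolding set_integrable_def
  by (rule Bochner_Integration.integrable_bound;
      auto split: split_indicator simp: norm_mult norm_power abs_mult
        intro!: AE_I2 mult_left_le)+

text \<open>\<open>has_bochner_integral\<close> delivers integrability and value together, so the
  finite cosine expansion can be integrated term by term.\<close>

lemma pf_moment:
  assumes "m \<ge> 1"
  shows "has_bochner_integral lborel
    (\<lambda>t. indicator {0..} t *\<^sub>R (t ^ k * exp (- t) * pf_W m (pf_omega m * (t - 1)))) (pf_M k m)"
proof -
  define w where "w = pf_omega m"
  let ?J = "\<lambda>a t::real. indicator {0..} t *\<^sub>R (t ^ k * exp (- t) * cos (a * t))"
  let ?S = "\<lambda>a t::real. indicator {0..} t *\<^sub>R (t ^ k * exp (- t) * sin (a * t))"
  have J: "has_bochner_integral lborel (?J a) (J_int k a)" for a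
    using set_integrable_power_exp_cos_sin(1)[of k a]
    by (simp add: has_bochner_integral_iff set_integrable_def J_int_def set_lebesgue_integral_def)
  have S: "has_bochner_integral lborel (?S a) (S_int k a)" for a
    using set_integrable_power_exp_cos_sin(2)[of k a]
    by (simp add: has_bochner_integral_iff set_integrable_def S_int_def set_lebesgue_integral_def)
  have "has_bochner_integral lborel
     (\<lambda>t. pf_B m 0 * ?J 0 t + 2 * (\<Sum>l = 1..pf_L m. pf_B m (int l) *
       (cos (real l * w) * ?J (real l * w) t + sin (real l * w) * ?S (real l * w) t)))
     (pf_M k m)"
    unfolding pf_M_def w_def[symmetric]
    by (intro has_bochner_integral_add has_bochner_integral_mult_right has_bochner_integral_sum J S)
  also have "(\<lambda>t. pf_B m 0 * ?J 0 t + 2 * (\<Sum>l = 1..pf_L m. pf_B m (int l) *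
       (cos (real l * w) * ?J (real l * w) t + sin (real l * w) * ?S (real l * w) t)))
     = (\<lambda>t. indicator {0..} t *\<^sub>R (t ^ k * exp (- t) * pf_W m (w * (t - 1))))"
  proof
    fix t :: real
    \<comment> \<open>The shift by 1 contributes the constants \<open>cos (real l * w)\<close> and
      \<open>sin (real l * w)\<close>, leaving integrands of \<open>J_int\<close> and
      \<open>S_int\<close>.\<close>
    have "cos (real l * (w * (t - 1)))
        = cos (real l * w) * cos (real l * w * t) + sin (real l * w) * sin (real l * w * t)" for l
      using cos_diff[of "real l * w * t" "real l * w"] by (simp add: algebra_simps)
    then show "pf_B m 0 * ?J 0 t + 2 * (\<Sum>l = 1..pf_L m. pf_B m (int l) *
       (cos (real l * w) * ?J (real l * w) t + sin (real l * w) * ?S (real l * w) t))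
     = indicator {0..} t *\<^sub>R (t ^ k * exp (- t) * pf_W m (w * (t - 1)))"
      unfolding pf_W_cosine_expansion[OF assms]
      by (simp add: algebra_simps sum_distrib_left)
  qed
  finally show ?thesis
    by (simp add: w_def)
qed

text \<open>By \<open>pf_moment\<close> this is the integral of a continuous nonnegative function
  that is positive near t = 1. It justifies every later division by \<open>pf_M\<close>.\<close>

lemma pf_M_pos:
  assumes "m \<ge> 1"
  shows "pf_M k m > 0"
proof -
  define g where "g = (\<lambda>t. t ^ k * exp (- t) * pf_W m (pf_omega m * (t - 1)))"
  have cont: "continuous_on UNIV g"
    unfolding g_def by (intro continuous_intros)
  have nonneg: "indicator {0..} t *\<^sub>R g t \<ge> 0" for t :: real
    using pf_W_nonneg[OF assms] by (auto simp: g_def split: split_indicator)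
  have mom: "has_bochner_integral lborel (\<lambda>t. indicator {0..} t *\<^sub>R g t) (pf_M k m)"
    unfolding g_def by (rule pf_moment[OF assms])
  \<comment> \<open>At t = 1 the argument of \<open>pf_W\<close> is 0, whatever the value of
    \<open>pf_omega m\<close>.\<close>
  have "g 1 > 0"
    by (simp add: g_def pf_W_def fejer_kernel_0)
  then have "\<forall>\<^sub>F t in at 1. g t > 0"
    using cont by (intro order_tendstoD(1)[of g "g 1"]) (auto simp: continuous_on_def)
  then obtain d where d: "d > 0" "\<And>t. t \<noteq> 1 \<Longrightarrow> dist t 1 < d \<Longrightarrow> g t > 0"
    unfolding eventually_at by auto
  have "pf_M k m \<ge> 0"
    unfolding has_bochner_integral_integral_eq[OF mom, symmetric]
    by (intro integral_nonneg_AE AE_I2 nonneg)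
  moreover have "pf_M k m \<noteq> 0"
  proof
    assume "pf_M k m = 0"
    then have "AE t in lborel. indicator {0..} t *\<^sub>R g t = 0"
      using integral_nonneg_eq_0_iff_AE[of lborel "\<lambda>t. indicator {0..} t *\<^sub>R g t"] mom nonneg
      by (simp add: has_bochner_integral_iff)
    \<comment> \<open>The interval to the right of 1 stays in the half-line and avoids t = 1, which
      the punctured neighbourhood excludes. Its measure d > 0 gives the contradiction.\<close>
    then have "AE t in lborel. t \<notin> {1<..<1 + d}"
    proof eventually_elim
      case (elim t)
      then show ?case
        using d(2)[of t] by (auto simp: dist_real_def)
    qed
    then have "emeasure lborel {1<..<1 + d} = 0"
      by (subst (asm) AE_iff_measurable[OF _ refl])
        (auto simp: greaterThanLessThan_def greaterThan_def lessThan_def Int_def)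
    then show False
      using d(1) by simp
  qed
  ultimately show ?thesis
    by simp
qed

section \<open>Normalising constant, density and moments of the random variable\<close>

lemma pf_C_eq:
  assumes "m \<ge> 1"
  shows "pf_C m = inverse (pf_M 0 m)"
proof -
  have "(LBINT t:{0..}. exp (- t) * pf_W m (pf_omega m * (t - 1))) = pf_M 0 m"
    using has_bochner_integral_integral_eq[OF pf_moment[OF assms, of 0]]
    by (simp add: set_lebesgue_integral_def)
  then have "(LBINT t:{0..}. C * exp (- t) * pf_W m (pf_omega m * (t - 1))) = C * pf_M 0 m" for C
    by (simp only: mult.assoc set_integral_mult_right)
  \<comment> \<open>The integral is linear in C with positive slope, so the description in
    \<open>pf_C\<close> has exactly one solution.\<close>
  moreover have "C > 0 \<and> C * pf_M 0 m = 1 \<longleftrightarrow> C = inverse (pf_M 0 m)" for C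
  proof -
    have "C * pf_M 0 m = 1 \<longleftrightarrow> C = inverse (pf_M 0 m)"
      using pf_M_pos[OF assms, of 0] by (auto simp: field_simps)
    then show ?thesis
      using pf_M_pos[OF assms, of 0] by auto
  qed
  ultimately show ?thesis
    by (simp add: pf_C_def)
qed

lemma pf_density_nonneg: "m \<ge> 1 \<Longrightarrow> pf_density m t \<ge> 0"
  using pf_M_pos[of m 0] by (simp add: pf_density_def pf_C_eq pf_W_nonneg)

lemma pf_density_moment:
  assumes "m \<ge> 1"
  shows "has_bochner_integral lborel (\<lambda>t. pf_density m t * t ^ k) (pf_M k m / pf_M 0 m)"
proof -
  have "has_bochner_integral lborel
     (\<lambda>t. pf_C m * (indicator {0..} t *\<^sub>R (t ^ k * exp (- t) * pf_W m (pf_omega m * (t - 1)))))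
     (pf_C m * pf_M k m)"
    by (intro has_bochner_integral_mult_right pf_moment assms)
  also have "(\<lambda>t. pf_C m * (indicator {0..} t *\<^sub>R (t ^ k * exp (- t) * pf_W m (pf_omega m * (t - 1)))))
     = (\<lambda>t. pf_density m t * t ^ k)"
    by (auto simp: pf_density_def fun_eq_iff)
  finally show ?thesis
    by (simp add: pf_C_eq[OF assms] field_simps)
qed

text \<open>Transfers the moments from Lebesgue measure to \<open>P\<close>; nonnegativity of the
  density lets the real density be recovered from its \<open>ennreal\<close> version.\<close>

lemma distributed_pf_moment:
  assumes "m \<ge> 1" "distributed P lborel X (\<lambda>t. ennreal (pf_density m t))"
  shows "has_bochner_integral P (\<lambda>\<xi>. X \<xi> ^ k) (pf_M k m / pf_M 0 m)"
  using pf_density_moment[OF assms(1), of k]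
    distributed_integral[OF assms(2), of "\<lambda>t. t ^ k"]
    distributed_integrable[OF assms(2), of "\<lambda>t. t ^ k"] pf_density_nonneg[OF assms(1)]
  by (simp add: has_bochner_integral_iff)

theorem theorem2:
  fixes m :: nat and P :: "'a measure" and X :: "'a \<Rightarrow> real"
  assumes "m \<ge> 2"
    and "prob_space P"
    and "distributed P lborel X (\<lambda>t. ennreal (pf_density m t))"
  shows "pf_C m = inverse (pf_M 0 m)
    \<and> prob_space.expectation P X = pf_M 1 m / pf_M 0 m
    \<and> prob_space.expectation P (\<lambda>\<xi>. (X \<xi>)\<^sup>2) = pf_M 2 m / pf_M 0 m
    \<and> scv P X = pf_M 2 m * pf_M 0 m / (pf_M 1 m)\<^sup>2 - 1"
proof -
  interpret prob_space P by fact
  have m: "m \<ge> 1" using assms(1) by simp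
  have 1: "integrable P X" "expectation X = pf_M 1 m / pf_M 0 m"
    using distributed_pf_moment[OF m assms(3), of 1] by (simp_all add: has_bochner_integral_iff)
  have 2: "integrable P (\<lambda>\<xi>. (X \<xi>)\<^sup>2)" "expectation (\<lambda>\<xi>. (X \<xi>)\<^sup>2) = pf_M 2 m / pf_M 0 m"
    using distributed_pf_moment[OF m assms(3), of 2] by (simp_all add: has_bochner_integral_iff)
  have "scv P X = (pf_M 2 m / pf_M 0 m - (pf_M 1 m / pf_M 0 m)\<^sup>2) / (pf_M 1 m / pf_M 0 m)\<^sup>2"
    unfolding scv_def variance_eq[OF 1(1) 2(1)] unfolding 1(2) 2(2) by (rule refl)
  \<comment> \<open>Positivity of \<open>pf_M 0 m\<close> and \<open>pf_M 1 m\<close> allows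
    clearing the denominators; the squared mean divided by itself gives the -1.\<close>
  also have "\<dots> = pf_M 2 m * pf_M 0 m / (pf_M 1 m)\<^sup>2 - 1"
    using pf_M_pos[OF m, of 0] pf_M_pos[OF m, of 1] by (simp add: field_simps power2_eq_square)
  finally show ?thesis
    using pf_C_eq[OF m] 1(2) 2(2) by blast
qed

end
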